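(* Let $1 \leq t \leq r_1 \leq \dots \leq r_k$ (with $k\geq 2$), and for each $i \in [k]$ let $\mathcal{F}_i$ be a $(\leq r_i)$-family and $m_i$ an integer with $m_i \geq c(r_{k-1},r_k,t)$. Then $(\mathcal{S}_{\mathcal{F}_1,m_1}, \dots, \mathcal{S}_{\mathcal{F}_k,m_k})$ has the strict cross-$t$-star property.
   Context: All sets and families are finite. For an $r$-element set $X=\{x_1,\dots,x_r\}$ and integer $m\geq1$, $\mathcal{S}_{X,m}=\{\{(x_1,y_1),\dots,(x_r,y_r)\}: y_1,\dots,y_r\in[m]\}$, with $\mathcal{S}_{\emptyset,m}=\emptyset$; for a family $\mathcal{F}$, $\mathcal{S}_{\mathcal{F},m}=\bigcup_{F\in\mathcal{F}}\mathcal{S}_{F,m}$. A $(\leq r)$-family is one whose sets each have at most $r$ elements. $c(r,s,t)=\max\{r\binom{s}{t},s\binom{r}{t}\}+1$ if $t\leq\min\{r,s\}$, and $1$ otherwise. $\mathcal{G}(T)=\{G\in\mathcal{G}:T\subseteq G\}$ and $l(\mathcal{G},t)=\max_{|T|=t}|\mathcal{G}(T)|$. Families $\mathcal{A}_1,\dots,\mathcal{A}_k$ are cross-$t$-intersecting if for all distinct $i,j$ each set of $\mathcal{A}_i$ shares at least $t$ elements with each set of $\mathcal{A}_j$; the tuple is below $(\mathcal{G}_1,\dots,\mathcal{G}_k)$ if $\mathcal{A}_i\subseteq\mathcal{G}_i$. $(\mathcal{G}_1,\dots,\mathcal{G}_k)$ has the strict cross-$t$-star property if for every cross-$t$-intersecting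 tuple below it, $\prod|\mathcal{A}_i|\leq\prod l(\mathcal{G}_i,t)$, with strict inequality unless there is a $t$-set $T$ with $\mathcal{A}_i=\mathcal{G}_i(T)$ for all $i$.
   Formalization: The inequality of products is proved in full, but the strictness clause only when every F_i has a member with at least t elements; otherwise it is false, e.g. t=r_1=r_2=1, m_i=2, F_1 empty, F_2={{x}}, A_1 empty, A_2 all of S_{F_2,2}. *)

theory Defs
  imports Main "HOL-Library.FuncSet"
begin

text \<open>Labelled sets: \<open>labelled X m\<close> is the family S_{X,m} of all graphs of functions
  from \<open>X\<close> to \<open>[m] = {1..m}\<close>.  The uniform formula would give \<open>{{}}\<close> for empty \<open>X\<close>;
  the convention is that S_{{},m} is empty.\<close>

definition labelled :: "'a set \<Rightarrow> nat \<Rightarrow> ('a \<times> nat) set set" where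
  "labelled X m =
     (if X = {} then {} else {(\<lambda>x. (x, y x)) ` X | y. y \<in> X \<rightarrow> {1..m}})"

definition labelled_family :: "'a set set \<Rightarrow> nat \<Rightarrow> ('a \<times> nat) set set" where
  "labelled_family F m = (\<Union>X\<in>F. labelled X m)"

definition le_family :: "nat \<Rightarrow> 'a set set \<Rightarrow> bool" where
  "le_family r F \<longleftrightarrow> finite F \<and> (\<forall>X\<in>F. finite X \<and> card X \<le> r)"

definition c_bound :: "nat \<Rightarrow> nat \<Rightarrow> nat \<Rightarrow> nat" where
  "c_bound r s t =
     (if t \<le> min r s then max (r * (s choose t)) (s * (r choose t)) + 1 else 1)"

definition star_of :: "'b set set \<Rightarrow> 'b set \<Rightarrow> 'b set set" where
  "star_of G T = {A \<in> G. T \<subseteq> A}"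

text \<open>The maximum ranges over all \<open>t\<close>-sets of the ambient type.  Over an infinite type (such as
  \<open>'a \<times> nat\<close>) and for a finite family it is taken over a finite nonempty set of numbers, and it
  is 0 when no member of \<open>G\<close> has at least \<open>t\<close> elements.\<close>

definition max_star :: "'b set set \<Rightarrow> nat \<Rightarrow> nat" where
  "max_star G t = Max {card (star_of G T) | T. finite T \<and> card T = t}"

text \<open>Tuples of families are functions on \<open>nat\<close>, of which only the entries with index in
  \<open>{1..k}\<close> matter.\<close>

definition cross_intersecting :: "nat \<Rightarrow> nat \<Rightarrow> (nat \<Rightarrow> 'b set set) \<Rightarrow> bool" where
  "cross_intersecting t k \<A> \<longleftrightarrow>
     (\<forall>i\<in>{1..k}. \<forall>j\<in>{1..k}. i \<noteq> j \<longrightarrow> (\<forall>A\<in>\<A> i. \<forall>B\<in>\<A> j. t \<le> card (A \<inter> B)))"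

definition below :: "nat \<Rightarrow> (nat \<Rightarrow> 'b set set) \<Rightarrow> (nat \<Rightarrow> 'b set set) \<Rightarrow> bool" where
  "below k \<A> \<G> \<longleftrightarrow> (\<forall>i\<in>{1..k}. \<A> i \<subseteq> \<G> i)"

definition cross_star_property :: "nat \<Rightarrow> nat \<Rightarrow> (nat \<Rightarrow> 'b set set) \<Rightarrow> bool" where
  "cross_star_property t k \<G> \<longleftrightarrow>
     (\<forall>\<A>. cross_intersecting t k \<A> \<and> below k \<A> \<G> \<longrightarrow>
        (\<Prod>i\<in>{1..k}. card (\<A> i)) \<le> (\<Prod>i\<in>{1..k}. max_star (\<G> i) t))"

text \<open>If some \<open>max_star (\<G> i) t\<close> is 0, both products are 0 for every admissible tuple (if
  \<open>k \<ge> 2\<close>), so the strictness clause then says that all admissible tuples are stars.  For labelled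
  families this fails unless all of them are empty: with \<open>\<G> 1 = {}\<close> one may take \<open>\<A> 1 = {}\<close> and
  \<open>\<A> 2\<close> arbitrary.  So the strict property can only be expected when every \<open>\<G> i\<close> has a member
  with at least \<open>t\<close> elements.\<close>

definition strict_cross_star_property :: "nat \<Rightarrow> nat \<Rightarrow> (nat \<Rightarrow> 'b set set) \<Rightarrow> bool" where
  "strict_cross_star_property t k \<G> \<longleftrightarrow>
     (\<forall>\<A>. cross_intersecting t k \<A> \<and> below k \<A> \<G> \<longrightarrow>
        (\<Prod>i\<in>{1..k}. card (\<A> i)) \<le> (\<Prod>i\<in>{1..k}. max_star (\<G> i) t) \<and>
        ((\<Prod>i\<in>{1..k}. card (\<A> i)) < (\<Prod>i\<in>{1..k}. max_star (\<G> i) t) \<or>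
         (\<exists>T. finite T \<and> card T = t \<and> (\<forall>i\<in>{1..k}. \<A> i = star_of (\<G> i) T))))"

end

theory Submission imports Defs begin

text \<open>The family \<open>G = labelled_family F m\<close> satisfies \<open>m * max_star G (t + 1) \<le> max_star G t\<close>,
  since the label of a fixed element can be changed in \<open>m\<close> ways.  For two cross-\<open>t\<close>-intersecting
  families \<open>A\<close>, \<open>B\<close>, covering \<open>A\<close> by the stars of the \<open>t\<close>-subsets of one member of \<open>B\<close> loses only a
  factor \<open>s choose t\<close>, while a star of \<open>A\<close> whose centre is not contained in every member of \<open>B\<close> is
  covered by at most \<open>s\<close> stars of \<open>(t + 1)\<close>-sets.  So the product is too small unless both families
  lie in a common star.  For \<open>k\<close> families the two-family bound is multiplied along the cycle
  \<open>1, 2, \<dots>, k, 1\<close>, which bounds the square of the product.\<close>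

section \<open>Stars\<close>

lemma finite_star_of: "finite G \<Longrightarrow> finite (star_of G T)"
  by (simp add: star_of_def)

lemma star_of_mono: "A \<subseteq> G \<Longrightarrow> star_of A T \<subseteq> star_of G T"
  by (auto simp: star_of_def)

lemma finite_star_cards:
  assumes "finite G"
  shows "finite {card (star_of G T) | T. finite T \<and> card T = n}"
proof (rule finite_subset)
  show "{card (star_of G T) | T. finite T \<and> card T = n} \<subseteq> {..card G}"
    using assms by (auto simp: star_of_def intro!: card_mono)
qed simp

lemma card_star_le_max_star:
  assumes "finite G" "finite T" "card T = n"
  shows "card (star_of G T) \<le> max_star G n"
  unfolding max_star_def using assms finite_star_cards[OF assms(1), of n]
  by (intro Max_ge) auto

lemma card_star_sub_le_max_star:
  assumes "A \<subseteq> G" "finite G" "finite T" "card T = n"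
  shows "card (star_of A T) \<le> max_star G n"
  using card_mono[OF finite_star_of[OF assms(2)] star_of_mono[OF assms(1), of T]]
    card_star_le_max_star[OF assms(2-4)] by linarith

text \<open>In an infinite type there is a set of every finite size, so \<open>Max\<close> is taken
  over a nonempty finite set and is one of its elements.\<close>

lemma max_star_attained:
  fixes G :: "'b set set"
  assumes "infinite (UNIV :: 'b set)" "finite G"
  obtains T where "finite T" "card T = n" "max_star G n = card (star_of G T)"
proof -
  obtain S :: "'b set" where "finite S" "card S = n"
    using infinite_arbitrarily_large[OF assms(1)] by blast
  then have "{card (star_of G T) | T. finite T \<and> card T = n} \<noteq> {}" by blast
  from Max_in[OF finite_star_cards[OF assms(2)] this] show ?thesis
    using that unfolding max_star_def by blast
qed

lemma max_star_pos:
  assumes "finite G" "B \<in> G" "n \<le> card B"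
  shows "0 < max_star G n"
proof -
  obtain T where T: "T \<subseteq> B" "card T = n" "finite T"
    using assms(3) by (metis obtain_subset_with_card_n)
  then have "B \<in> star_of G T" using assms by (simp add: star_of_def)
  then have "0 < card (star_of G T)"
    using finite_star_of[OF assms(1)] card_gt_0_iff by blast
  with card_star_le_max_star[OF assms(1) T(3,2)] show ?thesis by linarith
qed

section \<open>Two cross-intersecting families\<close>

text \<open>Each member of \<open>A\<close> contains some \<open>t\<close>-subset of the fixed set
  \<open>B\<close>, so the stars of these at most \<open>s choose t\<close> subsets cover
  \<open>A\<close>.\<close>

lemma card_le_choose_stars:
  assumes fin: "finite A" and B: "finite B" "card B \<le> s"
    and cross: "\<And>X. X \<in> A \<Longrightarrow> t \<le> card (X \<inter> B)"
    and star: "\<And>T. finite T \<Longrightarrow> card T = t \<Longrightarrow> card (star_of A T) \<le> N"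
  shows "card A \<le> (s choose t) * N"
proof -
  let ?Q = "{T. T \<subseteq> B \<and> card T = t}"
  have finQ: "finite ?Q" using B by simp
  have "A \<subseteq> (\<Union>T\<in>?Q. star_of A T)"
  proof
    fix X assume X: "X \<in> A"
    obtain T where "T \<subseteq> X \<inter> B" "card T = t"
      using cross[OF X] by (metis obtain_subset_with_card_n)
    then show "X \<in> (\<Union>T\<in>?Q. star_of A T)" using X by (auto simp: star_of_def)
  qed
  then have "card A \<le> card (\<Union>T\<in>?Q. star_of A T)"
    using fin finQ by (intro card_mono) (auto simp: finite_star_of)
  also have "\<dots> \<le> (\<Sum>T\<in>?Q. card (star_of A T))"
    by (rule card_UN_le[OF finQ])
  also have "\<dots> \<le> (\<Sum>T\<in>?Q. N)"
    using B by (intro sum_mono star) (auto intro: finite_subset)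
  also have "\<dots> = (card B choose t) * N" using n_subsets[OF B(1), of t] by simp
  also have "\<dots> \<le> (s choose t) * N"
    using B(2) by (intro mult_right_mono binomial_right_mono) auto
  finally show ?thesis .
qed

text \<open>Since \<open>T\<close> is not inside \<open>B\<close>, it supplies fewer than
  \<open>t\<close> elements of an intersection with \<open>B\<close>. A member of the star must
  therefore contain a further element of \<open>B - T\<close>, and it lies in the star of one of at
  most \<open>s\<close> sets of size \<open>t + 1\<close>.\<close>

lemma card_star_le_avoiding:
  assumes AG: "A \<subseteq> G" "finite G" and T: "finite T" "card T = t"
    and B: "finite B" "card B \<le> s" "\<not> T \<subseteq> B"
    and cross: "\<And>X. X \<in> A \<Longrightarrow> t \<le> card (X \<inter> B)"
  shows "card (star_of A T) \<le> s * max_star G (Suc t)"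
proof -
  have finA: "finite A" using AG finite_subset by blast
  have "star_of A T \<subseteq> (\<Union>x\<in>B - T. star_of A (insert x T))"
  proof
    fix X assume X: "X \<in> star_of A T"
    have "\<not> X \<inter> B \<subseteq> T"
    proof
      assume "X \<inter> B \<subseteq> T"
      then have "X \<inter> B \<subset> T" using B(3) by blast
      then have "card (X \<inter> B) < t" using T psubset_card_mono by blast
      moreover have "t \<le> card (X \<inter> B)" using X cross by (auto simp: star_of_def)
      ultimately show False by simp
    qed
    then show "X \<in> (\<Union>x\<in>B - T. star_of A (insert x T))"
      using X by (auto simp: star_of_def)
  qed
  then have "card (star_of A T) \<le> card (\<Union>x\<in>B - T. star_of A (insert x T))"
    using finA B by (intro card_mono) (auto simp: finite_star_of)
  also have "\<dots> \<le> (\<Sum>x\<in>B - T. card (star_of A (insert x T)))"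
    using B by (intro card_UN_le) auto
  also have "\<dots> \<le> (\<Sum>x\<in>B - T. max_star G (Suc t))"
    using AG T by (intro sum_mono card_star_sub_le_max_star) auto
  also have "\<dots> = card (B - T) * max_star G (Suc t)" by simp
  also have "\<dots> \<le> s * max_star G (Suc t)"
    using B card_mono[of B "B - T"] by (intro mult_right_mono) auto
  finally show ?thesis .
qed

text \<open>This is the case where \<open>T\<close> is a centre for \<open>B\<close> but is missed
  by a member \<open>A0\<close> of \<open>A\<close>. Covering \<open>A\<close> costs the factor
  \<open>s choose t\<close>, while \<open>A0\<close> forces \<open>B\<close> down to the scale of
  \<open>max_star H (Suc t)\<close>; the gap in \<open>H\<close> outweighs the combined factor
  \<open>r * (s choose t)\<close>.\<close>

lemma mixed_star_bound:
  assumes A: "A \<subseteq> G" "finite G" and B: "B \<subseteq> H" "finite H"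
    and sizes: "\<And>X. X \<in> A \<Longrightarrow> finite X \<and> card X \<le> r" "\<And>Y. Y \<in> B \<Longrightarrow> finite Y \<and> card Y \<le> s"
    and cross: "\<And>X Y. X \<in> A \<Longrightarrow> Y \<in> B \<Longrightarrow> t \<le> card (X \<inter> Y)"
    and C: "r * (s choose t) \<le> C" "C * max_star H (Suc t) < max_star H t"
    and pos: "0 < max_star G t" and ne: "B \<noteq> {}"
    and T: "finite T" "card T = t" "\<And>Y. Y \<in> B \<Longrightarrow> T \<subseteq> Y" and A0: "A0 \<in> A" "\<not> T \<subseteq> A0"
  shows "card A * card B < max_star G t * max_star H t"
proof -
  obtain B0 where B0: "B0 \<in> B" using ne by blast
  have finA: "finite A" using A finite_subset by blast
  \<comment> \<open>As \<open>B\<close> is its own star at \<open>T\<close>, the bound for stars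
    avoiding \<open>A0\<close> applies to the whole of \<open>B\<close>.\<close>
  have "star_of B T = B" using T(3) by (auto simp: star_of_def)
  then have cB: "card B \<le> r * max_star H (Suc t)"
    using card_star_le_avoiding[OF B T(1,2), of A0 r] sizes(1)[OF A0(1)] A0(2)
      cross[OF A0(1)] by (simp add: Int_commute)
  have cA: "card A \<le> (s choose t) * max_star G t"
    using sizes(2)[OF B0] cross[OF _ B0] card_star_sub_le_max_star[OF A]
    by (intro card_le_choose_stars[OF finA, of B0]) auto
  have "card A * card B \<le> ((s choose t) * max_star G t) * (r * max_star H (Suc t))"
    using cA cB by (rule mult_le_mono)
  also have "\<dots> = max_star G t * ((r * (s choose t)) * max_star H (Suc t))" by (simp add: ac_simps)
  also have "\<dots> \<le> max_star G t * (C * max_star H (Suc t))"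
    using C(1) by (intro mult_le_mono) auto
  also have "\<dots> < max_star G t * max_star H t" using C(2) pos by simp
  finally show ?thesis .
qed

text \<open>The cases are whether some \<open>t\<close>-set lies in all members of \<open>B\<close>,
  in all members of \<open>A\<close>, or in neither. The first two are symmetric and end in a common
  star or in \<open>mixed_star_bound\<close>.\<close>

lemma two_family_star_bound:
  assumes A: "A \<subseteq> G" "finite G" and B: "B \<subseteq> H" "finite H"
    and sizes: "\<And>X. X \<in> A \<Longrightarrow> finite X \<and> card X \<le> r" "\<And>Y. Y \<in> B \<Longrightarrow> finite Y \<and> card Y \<le> s"
    and cross: "\<And>X Y. X \<in> A \<Longrightarrow> Y \<in> B \<Longrightarrow> t \<le> card (X \<inter> Y)"
    and C: "r * (s choose t) \<le> C" "s * (r choose t) \<le> C"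
    and G: "C * max_star G (Suc t) < max_star G t" and H: "C * max_star H (Suc t) < max_star H t"
  shows "card A * card B < max_star G t * max_star H t \<or>
    (\<exists>T. finite T \<and> card T = t \<and> A \<subseteq> star_of G T \<and> B \<subseteq> star_of H T)"
proof (cases "A = {} \<or> B = {}")
  case True
  \<comment> \<open>The left product is 0, and the strict gaps make both maxima on the right
    positive.\<close>
  then show ?thesis using G H by auto
next
  case False
  then obtain A0 B0 where A0: "A0 \<in> A" and B0: "B0 \<in> B" by blast
  have finA: "finite A" and finB: "finite B" using A B finite_subset by blast+
  have cross': "\<And>X Y. Y \<in> B \<Longrightarrow> X \<in> A \<Longrightarrow> t \<le> card (Y \<inter> X)"
    using cross by (simp add: Int_commute)
  have posG: "0 < max_star G t" and posH: "0 < max_star H t" using G H by auto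
  consider (B_star) T where "finite T" "card T = t" "\<And>Y. Y \<in> B \<Longrightarrow> T \<subseteq> Y"
    | (A_star) T where "finite T" "card T = t" "\<And>X. X \<in> A \<Longrightarrow> T \<subseteq> X"
    | (none) "\<And>T. finite T \<Longrightarrow> card T = t \<Longrightarrow> (\<exists>Y\<in>B. \<not> T \<subseteq> Y) \<and> (\<exists>X\<in>A. \<not> T \<subseteq> X)"
    by blast
  then show ?thesis
  proof cases
    case B_star
    show ?thesis
    proof (cases "\<forall>X\<in>A. T \<subseteq> X")
      case True
      then have "A \<subseteq> star_of G T" "B \<subseteq> star_of H T"
        using B_star A B by (auto simp: star_of_def)
      then show ?thesis using B_star by blast
    next
      case False
      then obtain X where "X \<in> A" "\<not> T \<subseteq> X" by blast
      from mixed_star_bound[OF A B sizes cross C(1) H posG _ B_star this] B0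
      show ?thesis by blast
    qed
  next
    case A_star
    show ?thesis
    proof (cases "\<forall>Y\<in>B. T \<subseteq> Y")
      case True
      then have "A \<subseteq> star_of G T" "B \<subseteq> star_of H T"
        using A_star A B by (auto simp: star_of_def)
      then show ?thesis using A_star by blast
    next
      case False
      then obtain Y where "Y \<in> B" "\<not> T \<subseteq> Y" by blast
      from mixed_star_bound[OF B A sizes(2,1) cross' C(2) G posH _ A_star this] A0
      show ?thesis by (auto simp: mult.commute)
    qed
  next
    case none
    \<comment> \<open>The member of \<open>B\<close> that avoids \<open>T\<close> varies with
      \<open>T\<close>, but the resulting bound does not, so it can serve as \<open>N\<close> in the
      covering lemma.\<close>
    have "card (star_of A T) \<le> s * max_star G (Suc t)" if T: "finite T" "card T = t" for T
    proof -
      obtain Y where Y: "Y \<in> B" "\<not> T \<subseteq> Y" using none[OF T] by blast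
      show ?thesis
        using sizes(2)[OF Y(1)] Y(2) cross[OF _ Y(1)]
        by (intro card_star_le_avoiding[OF A T, of Y]) auto
    qed
    then have cA: "card A \<le> (s choose t) * (s * max_star G (Suc t))"
      using sizes(2)[OF B0] cross[OF _ B0]
      by (intro card_le_choose_stars[OF finA, of B0]) auto
    have "card (star_of B T) \<le> r * max_star H (Suc t)" if T: "finite T" "card T = t" for T
    proof -
      obtain X where X: "X \<in> A" "\<not> T \<subseteq> X" using none[OF T] by blast
      show ?thesis
        using sizes(1)[OF X(1)] X(2) cross'[OF _ X(1)]
        by (intro card_star_le_avoiding[OF B T, of X]) auto
    qed
    then have cB: "card B \<le> (r choose t) * (r * max_star H (Suc t))"
      using sizes(1)[OF A0] cross'[OF _ A0]
      by (intro card_le_choose_stars[OF finB, of A0]) auto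
    \<comment> \<open>The factors \<open>s\<close> and \<open>r\<close> are exchanged between the two bounds: \<open>s * (s choose t)\<close> alone need
      not be at most \<open>C\<close>.\<close>
    have "card A * card B
        \<le> ((s choose t) * (s * max_star G (Suc t))) * ((r choose t) * (r * max_star H (Suc t)))"
      using cA cB by (rule mult_le_mono)
    also have "\<dots> = ((r * (s choose t)) * max_star G (Suc t)) * ((s * (r choose t)) * max_star H (Suc t))"
      by (simp add: ac_simps)
    also have "\<dots> \<le> (C * max_star G (Suc t)) * (C * max_star H (Suc t))"
      using C by (intro mult_le_mono) auto
    also have "\<dots> < max_star G t * max_star H t"
      using G H by (intro mult_strict_mono) auto
    finally show ?thesis by blast
  qed
qed

text \<open>Inside a common star each cardinality is at most the corresponding maximum, so either
  one falls short and the product is strict, or both families fill their stars. The equalities of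
  cardinalities are kept because identifying centres later requires a full star.\<close>

lemma two_family_strict_star:
  assumes A: "A \<subseteq> G" "finite G" and B: "B \<subseteq> H" "finite H"
    and sizes: "\<And>X. X \<in> A \<Longrightarrow> finite X \<and> card X \<le> r" "\<And>Y. Y \<in> B \<Longrightarrow> finite Y \<and> card Y \<le> s"
    and cross: "\<And>X Y. X \<in> A \<Longrightarrow> Y \<in> B \<Longrightarrow> t \<le> card (X \<inter> Y)"
    and C: "r * (s choose t) \<le> C" "s * (r choose t) \<le> C"
    and G: "C * max_star G (Suc t) < max_star G t" and H: "C * max_star H (Suc t) < max_star H t"
  shows "card A * card B < max_star G t * max_star H t \<or>
    (card A = max_star G t \<and> card B = max_star H t \<and>
     (\<exists>T. finite T \<and> card T = t \<and> A = star_of G T \<and> B = star_of H T))"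
proof -
  have "card A * card B < max_star G t * max_star H t \<or>
      (\<exists>T. finite T \<and> card T = t \<and> A \<subseteq> star_of G T \<and> B \<subseteq> star_of H T)"
    by (rule two_family_star_bound[OF A B sizes cross C G H])
  then consider "card A * card B < max_star G t * max_star H t"
    | T where "finite T" "card T = t" "A \<subseteq> star_of G T" "B \<subseteq> star_of H T" by blast
  then show ?thesis
  proof cases
    case 1
    then show ?thesis by simp
  next
    case T: (2 T)
    have finG: "finite (star_of G T)" and finH: "finite (star_of H T)"
      using A B finite_star_of by auto
    have GT: "card A \<le> card (star_of G T)" "card (star_of G T) \<le> max_star G t"
      using card_mono[OF finG T(3)] card_star_le_max_star[OF A(2) T(1,2)] by auto
    have HT: "card B \<le> card (star_of H T)" "card (star_of H T) \<le> max_star H t"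
      using card_mono[OF finH T(4)] card_star_le_max_star[OF B(2) T(1,2)] by auto
    show ?thesis
    proof (cases "card A = max_star G t \<and> card B = max_star H t")
      case True
      then have "A = star_of G T" "B = star_of H T"
        using GT HT card_subset_eq[OF finG T(3)] card_subset_eq[OF finH T(4)] by auto
      then show ?thesis using T True by blast
    next
      case False
      then consider "card A < max_star G t" "card B \<le> max_star H t"
        | "card A \<le> max_star G t" "card B < max_star H t"
        using GT HT by linarith
      then have "card A * card B < max_star G t * max_star H t"
      proof cases
        case 1
        then have "card A * card B \<le> card A * max_star H t" by simp
        also have "\<dots> < max_star G t * max_star H t" using 1 H by simp
        finally show ?thesis .
      next
        case 2
        then have "card A * card B \<le> max_star G t * card B" by simp
        also have "\<dots> < max_star G t * max_star H t" using 2 G by simp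
        finally show ?thesis .
      qed
      then show ?thesis by blast
    qed
  qed
qed

text \<open>Two different centres would put a common set of size \<open>t + 1\<close> into every
  member of the star, which is then too small to be maximal. This lets centres found for
  neighbouring pairs be identified.\<close>

lemma full_star_centre_unique:
  assumes "finite G" and T: "finite T" "card T = t" and U: "finite U" "card U = t"
    and eq: "star_of G T = star_of G U" and full: "card (star_of G T) = max_star G t"
    and lt: "max_star G (Suc t) < max_star G t"
  shows "T = U"
proof (rule ccontr)
  assume "T \<noteq> U"
  then obtain x where x: "x \<in> U" "x \<notin> T"
    using card_subset_eq[OF T(1), of U] T U by auto
  have "star_of G T = star_of G (insert x T)"
    using eq x by (auto simp: star_of_def set_eq_iff)
  then have "max_star G t \<le> max_star G (Suc t)"
    using card_star_le_max_star[OF assms(1), of "insert x T" "Suc t"] T x full by simp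
  with lt show False by simp
qed

section \<open>Many families\<close>

definition cyclic_next :: "nat \<Rightarrow> nat \<Rightarrow> nat" where
  "cyclic_next k i = (if i < k then Suc i else 1)"

lemma bij_betw_cyclic_next:
  assumes "1 \<le> k"
  shows "bij_betw (cyclic_next k) {1..k} {1..k}"
proof -
  have "inj_on (cyclic_next k) {1..k}"
    by (auto simp: inj_on_def cyclic_next_def split: if_splits)
  moreover have "cyclic_next k ` {1..k} \<subseteq> {1..k}"
    using assms by (auto simp: cyclic_next_def)
  ultimately show ?thesis
    by (simp add: bij_betw_def endo_inj_surj)
qed

text \<open>Each index occurs twice around the cycle, once as \<open>i\<close> and once as a
  successor. For \<open>k = 2\<close> the single pair is counted in both orders, which keeps the
  identity uniform.\<close>

lemma prod_mult_cyclic_next: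
  fixes a :: "nat \<Rightarrow> nat"
  assumes "1 \<le> k"
  shows "(\<Prod>i\<in>{1..k}. a i * a (cyclic_next k i)) = (\<Prod>i\<in>{1..k}. a i)\<^sup>2"
  using prod.reindex_bij_betw[OF bij_betw_cyclic_next[OF assms], of a]
  by (simp add: prod.distrib power2_eq_square)

lemma prod_strict_mono_nat:
  fixes f g :: "'i \<Rightarrow> nat"
  assumes "finite I" "\<And>i. i \<in> I \<Longrightarrow> f i \<le> g i" "\<And>i. i \<in> I \<Longrightarrow> 0 < g i"
    and "j \<in> I" "f j < g j"
  shows "prod f I < prod g I"
proof -
  \<comment> \<open>The factor at \<open>j\<close> is split off because \<open>f\<close> may vanish
    elsewhere: the other factors are first raised to \<open>g\<close>, whose product is positive,
    and only then is the strict inequality at \<open>j\<close> used.\<close>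
  have "prod f I = f j * prod f (I - {j})" using assms by (simp add: prod.remove)
  also have "\<dots> \<le> f j * prod g (I - {j})"
    using assms by (intro mult_le_mono prod_mono) auto
  also have "\<dots> < g j * prod g (I - {j})"
    using assms by (intro mult_strict_right_mono prod_pos) auto
  also have "\<dots> = prod g I" using assms by (simp add: prod.remove)
  finally show ?thesis .
qed

text \<open>The only facts about the families that enter are the size bounds and the gap between
  \<open>max_star\<close> at \<open>t + 1\<close> and at \<open>t\<close>, so the argument is
  independent of labellings.\<close>

lemma many_family_strict_star:
  fixes G :: "nat \<Rightarrow> 'b set set"
  assumes k: "2 \<le> k" and fin: "\<And>i. i \<in> {1..k} \<Longrightarrow> finite (G i)"
    and size: "\<And>i X. i \<in> {1..k} \<Longrightarrow> X \<in> G i \<Longrightarrow> finite X \<and> card X \<le> r i"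
    and C: "\<And>i j. i \<in> {1..k} \<Longrightarrow> j \<in> {1..k} \<Longrightarrow> i \<noteq> j \<Longrightarrow> r i * (r j choose t) \<le> C"
    and C1: "1 \<le> C"
    and lt: "\<And>i. i \<in> {1..k} \<Longrightarrow> C * max_star (G i) (Suc t) < max_star (G i) t"
  shows "strict_cross_star_property t k G"
  unfolding strict_cross_star_property_def
proof (intro allI impI)
  fix A :: "nat \<Rightarrow> 'b set set"
  assume "cross_intersecting t k A \<and> below k A G"
  then have cross: "\<And>i j X Y. i \<in> {1..k} \<Longrightarrow> j \<in> {1..k} \<Longrightarrow> i \<noteq> j \<Longrightarrow> X \<in> A i \<Longrightarrow> Y \<in> A j \<Longrightarrow> t \<le> card (X \<inter> Y)"
    and sub: "\<And>i. i \<in> {1..k} \<Longrightarrow> A i \<subseteq> G i"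
    by (auto simp: cross_intersecting_def below_def)
  let ?n = "cyclic_next k"
  let ?a = "\<lambda>i. card (A i)" and ?l = "\<lambda>i. max_star (G i) t"
  let ?eq = "\<lambda>i. ?a i = ?l i \<and> ?a (?n i) = ?l (?n i) \<and>
     (\<exists>T. finite T \<and> card T = t \<and> A i = star_of (G i) T \<and> A (?n i) = star_of (G (?n i)) T)"
  have next_in: "?n i \<in> {1..k}" "?n i \<noteq> i" if "i \<in> {1..k}" for i
    using that k by (auto simp: cyclic_next_def)
  have pair: "?a i * ?a (?n i) < ?l i * ?l (?n i) \<or> ?eq i" if i: "i \<in> {1..k}" for i
  proof (rule two_family_strict_star)
    note n = next_in[OF i]
    show "A i \<subseteq> G i" "finite (G i)" "A (?n i) \<subseteq> G (?n i)" "finite (G (?n i))"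
      using sub fin i n by auto
    show "finite X \<and> card X \<le> r i" if "X \<in> A i" for X
      using that sub[OF i] size[OF i] by auto
    show "finite X \<and> card X \<le> r (?n i)" if "X \<in> A (?n i)" for X
      using that sub[OF n(1)] size[OF n(1)] by auto
    show "t \<le> card (X \<inter> Y)" if "X \<in> A i" "Y \<in> A (?n i)" for X Y
      using cross[OF i n(1) n(2)[symmetric] that] .
    show "r i * (r (?n i) choose t) \<le> C" using C[OF i n(1) n(2)[symmetric]] .
    show "r (?n i) * (r i choose t) \<le> C" using C[OF n(1) i n(2)] .
    show "C * max_star (G i) (Suc t) < max_star (G i) t" using lt[OF i] .
    show "C * max_star (G (?n i)) (Suc t) < max_star (G (?n i)) t" using lt[OF n(1)] .
  qed
  have pos: "0 < ?l i" if "i \<in> {1..k}" for i using lt[OF that] by simp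
  show "prod ?a {1..k} \<le> prod ?l {1..k} \<and> (prod ?a {1..k} < prod ?l {1..k} \<or>
      (\<exists>T. finite T \<and> card T = t \<and> (\<forall>i\<in>{1..k}. A i = star_of (G i) T)))"
  proof (cases "\<forall>i\<in>{1..k}. ?eq i")
    case False
    then obtain j where j: "j \<in> {1..k}" "?a j * ?a (?n j) < ?l j * ?l (?n j)"
      using pair by blast
    \<comment> \<open>One strict pair makes the product around the cycle strict, and both sides are
      squares of the products to be compared.\<close>
    have "(\<Prod>i\<in>{1..k}. ?a i * ?a (?n i)) < (\<Prod>i\<in>{1..k}. ?l i * ?l (?n i))"
    proof (rule prod_strict_mono_nat[where j = j])
      show "j \<in> {1..k}" "?a j * ?a (?n j) < ?l j * ?l (?n j)" by (fact j)+
    next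
      fix i assume i: "i \<in> {1..k}"
      show "?a i * ?a (?n i) \<le> ?l i * ?l (?n i)" using pair[OF i] by fastforce
      show "0 < ?l i * ?l (?n i)" using pos[OF i] pos[OF next_in(1)[OF i]] by simp
    qed simp
    then have "(prod ?a {1..k})\<^sup>2 < (prod ?l {1..k})\<^sup>2"
      using prod_mult_cyclic_next[of k ?a] prod_mult_cyclic_next[of k ?l] k by simp
    then have "prod ?a {1..k} < prod ?l {1..k}"
      by (rule power_less_imp_less_base) simp
    then show ?thesis by simp
  next
    case True
    have "1 \<in> {1..k}" using k by simp
    then obtain T where T: "finite T" "card T = t" "A 1 = star_of (G 1) T"
      using True by blast
    \<comment> \<open>The centre \<open>T\<close> of \<open>A 1\<close> is carried from
      \<open>i\<close> to \<open>Suc i\<close>: the pair at \<open>i\<close> has some centre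
      \<open>U\<close>, and \<open>A i\<close> is a full star at both \<open>T\<close> and
      \<open>U\<close>.\<close>
    have "A i = star_of (G i) T" if "1 \<le> i" "i \<le> k" for i
      using that
    proof (induction i rule: dec_induct)
      case base
      show ?case by (rule T)
    next
      case (step i)
      then have i: "i \<in> {1..k}" and AT: "A i = star_of (G i) T" and ni: "?n i = Suc i"
        by (auto simp: cyclic_next_def)
      obtain U where U: "finite U" "card U = t" "A i = star_of (G i) U"
          "A (Suc i) = star_of (G (Suc i)) U"
        using True i unfolding ni[symmetric] by blast
      \<comment> \<open>With \<open>C \<ge> 1\<close> the gap gives the plain strict inequality
        between the two maxima that uniqueness of centres requires.\<close>
      have "max_star (G i) (Suc t) \<le> C * max_star (G i) (Suc t)" using C1 by simp
      then have "T = U"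
        using AT U(3) True i lt[OF i]
        by (intro full_star_centre_unique[OF fin[OF i] T(1,2) U(1,2)]) (simp, metis, linarith)
      then show ?case using U by simp
    qed
    then have "\<forall>i\<in>{1..k}. A i = star_of (G i) T" by simp
    moreover have "prod ?a {1..k} = prod ?l {1..k}" using True by (intro prod.cong) auto
    ultimately show ?thesis using T by auto
  qed
qed

text \<open>This handles the degenerate case, where no strict gap is available. If
  \<open>A i\<close> and another family were both nonempty, a member of \<open>A i\<close> would
  have at least \<open>t\<close> elements and make \<open>max_star G t\<close> positive.\<close>

lemma cross_intersecting_prod_card_eq_0:
  assumes k: "2 \<le> k" and cross: "cross_intersecting t k A"
    and i: "i \<in> {1..k}" "A i \<subseteq> G" and G: "finite G" "\<And>X. X \<in> G \<Longrightarrow> finite X" "max_star G t = 0"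
  shows "(\<Prod>i\<in>{1..k}. card (A i)) = 0"
proof (cases "A i = {}")
  case True
  then show ?thesis by (intro prod_zero bexI[OF _ i(1)]) simp_all
next
  case False
  then obtain X where X: "X \<in> A i" by blast
  define j where "j = (if i = 1 then 2 else 1 :: nat)"
  have j: "j \<in> {1..k}" "i \<noteq> j" using k by (auto simp: j_def)
  have "A j = {}"
  proof (rule ccontr)
    assume "A j \<noteq> {}"
    then obtain Y where "Y \<in> A j" by blast
    then have "t \<le> card (X \<inter> Y)"
      using cross i j X by (auto simp: cross_intersecting_def)
    also have "\<dots> \<le> card X" using G(2) X i by (intro card_mono) auto
    finally have "0 < max_star G t" using max_star_pos[OF G(1)] X i by blast
    then show False using G(3) by simp
  qed
  then show ?thesis by (intro prod_zero bexI[OF _ j(1)]) simp_all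
qed

section \<open>Labelled families\<close>

lemma mem_labelled_family:
  "A \<in> labelled_family F m \<longleftrightarrow>
    (\<exists>X\<in>F. X \<noteq> {} \<and> (\<exists>h\<in>X \<rightarrow> {1..m}. A = (\<lambda>x. (x, h x)) ` X))"
  by (auto simp: labelled_family_def labelled_def split: if_splits)

lemma finite_labelled_family:
  assumes "le_family r F"
  shows "finite (labelled_family F m)"
proof (rule finite_subset)
  show "labelled_family F m \<subseteq> Pow (\<Union>F \<times> {1..m})"
    by (fastforce simp: mem_labelled_family)
  show "finite (Pow (\<Union>F \<times> {1..m}))" using assms by (auto simp: le_family_def)
qed

lemma card_labelled:
  assumes "le_family r F" "A \<in> labelled_family F m"
  shows "finite A \<and> card A \<le> r"
proof -
  obtain X h where X: "X \<in> F" "A = (\<lambda>x. (x, h x)) ` X"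
    using assms(2) by (auto simp: mem_labelled_family)
  then have "finite X" "card X \<le> r" using assms(1) by (auto simp: le_family_def)
  then show ?thesis using X card_image_le[of X "\<lambda>x. (x, h x)"] by auto
qed

section \<open>Relabelling one element, and the ratio of consecutive star sizes\<close>

lemma labelled_family_functional:
  assumes "A \<in> labelled_family F m" "(x, y) \<in> A" "(x, z) \<in> A"
  shows "y = z"
  using assms by (auto simp: mem_labelled_family)

lemma relabel_mem_labelled_family:
  assumes A: "A \<in> labelled_family F m" "(x, y) \<in> A" and z: "z \<in> {1..m}"
  shows "insert (x, z) (A - {(x, y)}) \<in> labelled_family F m"
proof -
  obtain X h where X: "X \<in> F" "X \<noteq> {}" "h \<in> X \<rightarrow> {1..m}" "A = (\<lambda>x. (x, h x)) ` X"
    using A(1) by (auto simp: mem_labelled_family)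
  have "h(x := z) \<in> X \<rightarrow> {1..m}" using X(3) z by auto
  moreover have "insert (x, z) (A - {(x, y)}) = (\<lambda>u. (u, (h(x := z)) u)) ` X"
    using A(2) X(4) by auto
  ultimately show ?thesis using X(1,2) unfolding mem_labelled_family by blast
qed

text \<open>Take a largest star of a set \<open>T\<close> of size \<open>t + 1\<close> and drop one
  pair \<open>(x, y)\<close> from \<open>T\<close>. Giving \<open>x\<close> each of the
  \<open>m\<close> labels in each member embeds \<open>m\<close> copies of this star into the star
  of a \<open>t\<close>-set.\<close>

lemma max_star_labelled_family:
  fixes F :: "'a set set"
  assumes F: "le_family r F"
  shows "m * max_star (labelled_family F m) (Suc t) \<le> max_star (labelled_family F m) t"
proof -
  let ?G = "labelled_family F m"
  have fin: "finite ?G" using finite_labelled_family[OF F] .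
  have "infinite (UNIV :: ('a \<times> nat) set)" by (simp add: finite_prod)
  then obtain T where T: "finite T" "card T = Suc t" "max_star ?G (Suc t) = card (star_of ?G T)"
    using max_star_attained[OF _ fin] by blast
  have "T \<noteq> {}" using T(2) by auto
  then obtain x y where xy: "(x, y) \<in> T" by auto
  let ?S = "star_of ?G T"
  let ?f = "\<lambda>(z, A). insert (x, z) (A - {(x, y)})"
  have "inj_on ?f ({1..m} \<times> ?S)"
  proof (rule inj_onI, clarsimp)
    fix z A w B
    assume A: "A \<in> ?S" and B: "B \<in> ?S"
      and eq: "insert (x, z) (A - {(x, y)}) = insert (x, w) (B - {(x, y)})"
    \<comment> \<open>In a member of the star, \<open>y\<close> is the only label of
      \<open>x\<close>. After \<open>(x, y)\<close> is removed no label of \<open>x\<close> is left,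
      so the image determines both the new label and the original set.\<close>
    have only: "u = y" if "(x, u) \<in> A \<or> (x, u) \<in> B" for u
    proof -
      have "A \<in> ?G" "(x, y) \<in> A" "B \<in> ?G" "(x, y) \<in> B"
        using A B xy by (auto simp: star_of_def)
      then show ?thesis using that labelled_family_functional by metis
    qed
    have "(x, z) \<in> insert (x, w) (B - {(x, y)})" using eq by blast
    then have zw: "z = w" using only by auto
    have "A - {(x, y)} = B - {(x, y)}"
    proof -
      have "(x, w) \<notin> A - {(x, y)}" "(x, w) \<notin> B - {(x, y)}" using only by auto
      then show ?thesis using eq unfolding zw by (metis insert_ident)
    qed
    then show "z = w \<and> A = B"
      using A B xy zw by (auto simp: star_of_def)
  qed
  moreover have "?f ` ({1..m} \<times> ?S) \<subseteq> star_of ?G (T - {(x, y)})"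
  proof (rule image_subsetI)
    fix p assume "p \<in> {1..m} \<times> ?S"
    then obtain z A where p: "p = (z, A)" "z \<in> {1..m}" and A: "A \<in> ?G" "T \<subseteq> A"
      by (auto simp: star_of_def)
    have "insert (x, z) (A - {(x, y)}) \<in> ?G"
      using A xy p(2) by (intro relabel_mem_labelled_family) auto
    moreover have "T - {(x, y)} \<subseteq> insert (x, z) (A - {(x, y)})" using A(2) by blast
    ultimately show "?f p \<in> star_of ?G (T - {(x, y)})" by (simp add: p(1) star_of_def)
  qed
  ultimately have "card ({1..m} \<times> ?S) \<le> card (star_of ?G (T - {(x, y)}))"
    by (rule card_inj_on_le) (rule finite_star_of[OF fin])
  also have "\<dots> \<le> max_star ?G t"
    using T xy by (intro card_star_le_max_star[OF fin]) auto
  finally show ?thesis using T by (simp add: card_cartesian_product)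
qed

section \<open>Assembling the cross-star properties of labelled families\<close>

lemma max_star_labelled_family_pos:
  assumes F: "le_family r F" and X: "X \<in> F" "t \<le> card X" and "1 \<le> t" "1 \<le> m"
  shows "0 < max_star (labelled_family F m) t"
proof (rule max_star_pos[OF finite_labelled_family[OF F]])
  have "(\<lambda>_. 1) \<in> X \<rightarrow> {1..m}" using \<open>1 \<le> m\<close> by auto
  \<comment> \<open>Nonemptiness matters because \<open>labelled {} m\<close> is empty by
    convention.\<close>
  moreover have "X \<noteq> {}" using X(2) \<open>1 \<le> t\<close> by auto
  ultimately show "(\<lambda>x. (x, 1)) ` X \<in> labelled_family F m"
    using X(1) unfolding mem_labelled_family
    by (intro bexI[of _ X] conjI bexI[of _ "\<lambda>_. 1"]) simp_all
  show "t \<le> card ((\<lambda>x. (x, 1 :: nat)) ` X)"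
    using X(2) by (simp add: card_image inj_on_def)
qed

text \<open>The weak inequality is claimed in all cases. Strictness is claimed when every
  \<open>F i\<close> has a member with at least \<open>t\<close> elements; otherwise both products
  vanish, and tuples other than stars can attain equality.\<close>

theorem theorem4p2:
  fixes k t :: nat and r m :: "nat \<Rightarrow> nat" and F :: "nat \<Rightarrow> 'a set set"
  assumes "k \<ge> 2"
    and "1 \<le> t" and "t \<le> r 1"
    and "\<And>i j. 1 \<le> i \<Longrightarrow> i \<le> j \<Longrightarrow> j \<le> k \<Longrightarrow> r i \<le> r j"
    and "\<And>i. i \<in> {1..k} \<Longrightarrow> le_family (r i) (F i)"
    and "\<And>i. i \<in> {1..k} \<Longrightarrow> c_bound (r (k - 1)) (r k) t \<le> m i"
  shows "cross_star_property t k (\<lambda>i. labelled_family (F i) (m i)) \<and>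
    ((\<forall>i\<in>{1..k}. \<exists>X\<in>F i. t \<le> card X) \<longrightarrow>
      strict_cross_star_property t k (\<lambda>i. labelled_family (F i) (m i)))"
proof -
  let ?G = "\<lambda>i. labelled_family (F i) (m i)"
  \<comment> \<open>This is \<open>c_bound\<close> without its final \<open>+ 1\<close>, which is
    kept for the strictness of the gap.\<close>
  let ?C = "max (r (k - 1) * (r k choose t)) (r k * (r (k - 1) choose t))"
  note k = assms(1) and mono = assms(4) and F = assms(5)
  have t: "t \<le> r i" if "i \<in> {1..k}" for i
    using that assms(3) mono[of 1 i] by auto
  have "t \<le> r (k - 1)" "t \<le> r k" using t k by auto
  then have m: "?C + 1 \<le> m i" if "i \<in> {1..k}" for i
    using assms(6)[OF that] by (simp add: c_bound_def)
  have "1 \<le> r (k - 1) * (r k choose t)"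
    using \<open>t \<le> r (k - 1)\<close> \<open>t \<le> r k\<close> assms(2) by (simp add: Suc_le_eq)
  then have C1: "1 \<le> ?C" by (rule order_trans[OF _ max.cobounded1])
  \<comment> \<open>For \<open>i < j \<le> k\<close> also \<open>i \<le> k - 1\<close>, so by
    monotonicity the pair \<open>(k - 1, k)\<close> dominates every pair of indices.\<close>
  have C_lt: "r i * (r j choose t) \<le> ?C \<and> r j * (r i choose t) \<le> ?C"
    if "1 \<le> i" "i < j" "j \<le> k" for i j
  proof -
    have "r i \<le> r (k - 1)" "r j \<le> r k" using that mono by auto
    then have "r i * (r j choose t) \<le> r (k - 1) * (r k choose t)"
      "r j * (r i choose t) \<le> r k * (r (k - 1) choose t)"
      by (auto intro!: mult_le_mono binomial_right_mono)
    then show ?thesis by linarith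
  qed
  have C: "r i * (r j choose t) \<le> ?C" if "i \<in> {1..k}" "j \<in> {1..k}" "i \<noteq> j" for i j
    using that C_lt[of i j] C_lt[of j i] by (cases "i < j") auto
  have lt: "?C * max_star (?G i) (Suc t) < max_star (?G i) t"
    if i: "i \<in> {1..k}" and pos: "0 < max_star (?G i) t" for i
  \<comment> \<open>If the maximum at \<open>Suc t\<close> is 0, comparing \<open>?C\<close> with
    \<open>m i\<close> gives nothing strict, and positivity of the maximum at \<open>t\<close>
    supplies the gap.\<close>
  proof (cases "max_star (?G i) (Suc t) = 0")
    case True
    then show ?thesis using pos by simp
  next
    case False
    have "?C * max_star (?G i) (Suc t) < m i * max_star (?G i) (Suc t)"
      using m[OF i] False by (intro mult_strict_right_mono) auto
    also have "\<dots> \<le> max_star (?G i) t" using max_star_labelled_family[OF F[OF i]] .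
    finally show ?thesis .
  qed
  have strict: "strict_cross_star_property t k ?G" if "\<forall>i\<in>{1..k}. 0 < max_star (?G i) t"
    using that lt
    by (intro many_family_strict_star[OF k finite_labelled_family[OF F] card_labelled[OF F] C C1])
      auto
  have "cross_star_property t k ?G"
  proof (cases "\<forall>i\<in>{1..k}. 0 < max_star (?G i) t")
    case True
    then show ?thesis
      using strict by (auto simp: cross_star_property_def strict_cross_star_property_def)
  next
    case False
    then obtain i where i: "i \<in> {1..k}" "max_star (?G i) t = 0" by auto
    have "(\<Prod>i\<in>{1..k}. card (A i)) = 0" if "cross_intersecting t k A" "below k A ?G" for A
      using that(2) i card_labelled[OF F[OF i(1)]]
      by (intro cross_intersecting_prod_card_eq_0[OF k that(1) i(1), of "?G i"]
          finite_labelled_family[OF F]) (auto simp: below_def)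
    then show ?thesis unfolding cross_star_property_def by (metis zero_le)
  qed
  moreover have "strict_cross_star_property t k ?G" if large: "\<forall>i\<in>{1..k}. \<exists>X\<in>F i. t \<le> card X"
  proof (intro strict ballI)
    fix i assume i: "i \<in> {1..k}"
    then obtain X where "X \<in> F i" "t \<le> card X" using large by blast
    then show "0 < max_star (?G i) t"
      using max_star_labelled_family_pos[OF F[OF i]] assms(2) m[OF i] by auto
  qed
  ultimately show ?thesis by blast
qed

end
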